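(* Let $\rho_1,\rho_2,\rho_3$ be density matrices on a finite-dimensional complex Hilbert space of arbitrary dimension. Let $T=\delta_{12}+\delta_{13}+\delta_{23}$ with $\delta_{ij}=\frac12\|\rho_i-\rho_j\|_1$, and let $\beta=F(\{1,2,3\})-F(\{1,2\})-F(\{1,3\})-F(\{2,3\})$. Then $$\beta\le T-1-\frac{4T^2}{27}\le\frac23.$$
   Context: $\|\cdot\|_1$ is the trace norm. For density matrices $\rho_1,\rho_2,\rho_3$ and nonempty $H\subseteq\{1,2,3\}$, the minimum unnormalized discrimination error is $F(H)=|H|-D(H)$, where $D(H)=\max\sum_{i\in H}\operatorname{Tr}(\rho_iM_i)$, the maximum over all POVMs $(M_i)_{i\in H}$ (i.e. $M_i\ge0$, $\sum_{i\in H}M_i=\mathbb I$). *)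

theory Defs
  imports "Jordan_Normal_Form.Schur_Decomposition"
begin

text \<open>
  Operators on an \<open>n\<close>-dimensional complex Hilbert space are complex \<open>n \<times> n\<close> matrices,
  acting on \<open>carrier_vec n\<close> with the standard inner product \<open>\<bullet>c\<close>.
\<close>

definition mtrace :: "complex mat \<Rightarrow> complex" where
  "mtrace A = (\<Sum>i<dim_row A. A $$ (i, i))"

text \<open>
  The order on complex numbers is that of \<open>HOL-Library.Complex_Order\<close>, so \<open>0 \<le> z\<close> says that
  \<open>z\<close> is real and nonnegative. Hence the condition below forces \<open>A\<close> to be Hermitian.
\<close>

definition psd :: "nat \<Rightarrow> complex mat \<Rightarrow> bool" where
  "psd n A \<longleftrightarrow> A \<in> carrier_mat n n \<and> (\<forall>v \<in> carrier_vec n. 0 \<le> (A *\<^sub>v v) \<bullet>c v)"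

definition density_matrix :: "nat \<Rightarrow> complex mat \<Rightarrow> bool" where
  "density_matrix n \<rho> \<longleftrightarrow> psd n \<rho> \<and> mtrace \<rho> = 1"

text \<open>
  The singular values of a square matrix \<open>A\<close> are the square roots of the eigenvalues of
  \<open>A\<^sup>* A\<close>, taken with algebraic multiplicity. These eigenvalues are real and nonnegative,
  so \<open>Re\<close> loses nothing. The trace norm is the sum of the singular values, i.e. the trace of
  \<open>(A\<^sup>* A)\<close> to the power one half.
\<close>

definition singular_values :: "complex mat \<Rightarrow> real multiset" where
  "singular_values A =
     image_mset (\<lambda>z. sqrt (Re z)) (proots (char_poly (mat_adjoint A * A)))"

definition trace_norm :: "complex mat \<Rightarrow> real" where
  "trace_norm A = sum_mset (singular_values A)"

text \<open>The matrices \<open>M i\<close> with \<open>i \<notin> H\<close> are irrelevant. The matrix sum is taken entrywise.\<close>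

definition povm :: "nat \<Rightarrow> nat set \<Rightarrow> (nat \<Rightarrow> complex mat) \<Rightarrow> bool" where
  "povm n H M \<longleftrightarrow>
     (\<forall>i\<in>H. psd n (M i)) \<and> mat n n (\<lambda>rc. \<Sum>i\<in>H. M i $$ rc) = 1\<^sub>m n"

text \<open>
  The set of success values is nonempty and compact for finite nonempty \<open>H\<close>, so \<open>Sup\<close> is the
  maximum. Each \<open>mtrace (\<rho> i * M i)\<close> is real, being the trace of a product of positive
  semidefinite matrices.
\<close>

definition max_success :: "nat \<Rightarrow> (nat \<Rightarrow> complex mat) \<Rightarrow> nat set \<Rightarrow> real" where
  "max_success n \<rho> H = Sup {(\<Sum>i\<in>H. Re (mtrace (\<rho> i * M i))) | M. povm n H M}"

definition min_error :: "nat \<Rightarrow> (nat \<Rightarrow> complex mat) \<Rightarrow> nat set \<Rightarrow> real" where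
  "min_error n \<rho> H = real (card H) - max_success n \<rho> H"

definition trace_distance :: "complex mat \<Rightarrow> complex mat \<Rightarrow> real" where
  "trace_distance A B = 1 / 2 * trace_norm (A - B)"

end

theory Submission
  imports Defs "HOL-Analysis.L2_Norm"
begin

text \<open>
  Helstrom's bound gives \<open>D({i,j}) \<le> 1 + \<delta>\<^sub>i\<^sub>j\<close>, so it suffices to exhibit a POVM with success at
  least \<open>1 + 4T\<^sup>2/27\<close>. The pretty good measurement \<open>M\<^sub>i = G\<^bsup>-1/2\<^esup> \<rho>\<^sub>i G\<^bsup>-1/2\<^esup>\<close> with
  \<open>G = \<rho>\<^sub>1 + \<rho>\<^sub>2 + \<rho>\<^sub>3\<close> does this. Let \<open>Q(X)\<close> be the squared Hilbert--Schmidt norm of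
  \<open>G\<^bsup>-1/4\<^esup> X G\<^bsup>-1/4\<^esup>\<close>. The success of the measurement is \<open>P = \<Sum>\<^sub>i Q(\<rho>\<^sub>i)\<close>, and \<open>Q(G) = Tr G = 3\<close>,
  so \<open>\<Sum>\<^bsub>i<j\<^esub> Q(\<rho>\<^sub>i - \<rho>\<^sub>j) = 3P - 3\<close>. By the Cauchy--Schwarz inequality
  \<open>\<parallel>X\<parallel>\<^sub>1\<^sup>2 \<le> (Tr G) Q(X)\<close>, whence \<open>T\<^sup>2 \<le> 3 \<Sum>\<^bsub>i<j\<^esub> \<delta>\<^sub>i\<^sub>j\<^sup>2 \<le> 27(P - 1)/4\<close>.
\<close>

subsection \<open>Adjoints, traces and unitary conjugation\<close>

lemma mat_adjoint_dim [simp]: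
  "dim_row (mat_adjoint A) = dim_col A" "dim_col (mat_adjoint A) = dim_row A"
  by (auto simp: mat_adjoint_def)

lemma mat_adjoint_carrier [simp]:
  "A \<in> carrier_mat n m \<Longrightarrow> mat_adjoint A \<in> carrier_mat m n"
  by (intro carrier_matI) auto

lemma mult_carrier_square [simp]:
  "A \<in> carrier_mat n n \<Longrightarrow> B \<in> carrier_mat n n \<Longrightarrow> A * B \<in> carrier_mat n n"
  by (rule mult_carrier_mat)

lemma mat_adjoint_carrier_square [simp]:
  "A \<in> carrier_mat n n \<Longrightarrow> mat_adjoint A \<in> carrier_mat n n"
  by (rule mat_adjoint_carrier)

lemma mat_adjoint_index [simp]:
  assumes "i < dim_col A" "j < dim_row A"
  shows "mat_adjoint A $$ (i, j) = conjugate (A $$ (j, i))"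
  using assms by (simp add: mat_adjoint_def mat_of_rows_def)

lemma mat_adjoint_adjoint [simp]: "mat_adjoint (mat_adjoint A) = A"
  by (rule eq_matI) auto

lemma mat_adjoint_mult:
  fixes A B :: "'a :: conjugatable_field mat"
  assumes "A \<in> carrier_mat n m" "B \<in> carrier_mat m k"
  shows "mat_adjoint (A * B) = mat_adjoint B * mat_adjoint A"
  using assms
  by (intro eq_matI)
    (auto simp: scalar_prod_def sum_conjugate conjugate_dist_mul mult.commute intro!: sum.cong)

lemma mult_mat_index_sum:
  assumes "A \<in> carrier_mat n m" "B \<in> carrier_mat m k" "i < n" "j < k"
  shows "(A * B) $$ (i, j) = (\<Sum>l<m. A $$ (i, l) * B $$ (l, j))"
  using assms by (auto simp: scalar_prod_def lessThan_atLeast0)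

lemma mult_mat_vec_index_sum:
  assumes "A \<in> carrier_mat n m" "v \<in> carrier_vec m" "i < n"
  shows "(A *\<^sub>v v) $ i = (\<Sum>l<m. A $$ (i, l) * v $ l)"
  using assms by (auto simp: scalar_prod_def lessThan_atLeast0)

lemma mtrace_mult:
  assumes "A \<in> carrier_mat n m" "B \<in> carrier_mat m n"
  shows "mtrace (A * B) = (\<Sum>i<n. \<Sum>j<m. A $$ (i, j) * B $$ (j, i))"
  using assms by (auto simp: mtrace_def scalar_prod_def lessThan_atLeast0)

lemma mtrace_mult_comm:
  assumes "A \<in> carrier_mat n m" "B \<in> carrier_mat m n"
  shows "mtrace (A * B) = mtrace (B * A)"
  unfolding mtrace_mult[OF assms] mtrace_mult[OF assms(2,1)]
  by (subst sum.swap) (simp add: mult.commute)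

lemma mtrace_add:
  assumes "A \<in> carrier_mat n n" "B \<in> carrier_mat n n"
  shows "mtrace (A + B) = mtrace A + mtrace B"
  using assms by (auto simp: mtrace_def sum.distrib)

lemma mtrace_minus:
  assumes "A \<in> carrier_mat n n" "B \<in> carrier_mat n n"
  shows "mtrace (A - B) = mtrace A - mtrace B"
  using assms by (auto simp: mtrace_def sum_subtractf)

section \<open>Diagonal matrices\<close>

definition diag_of :: "nat \<Rightarrow> (nat \<Rightarrow> complex) \<Rightarrow> complex mat" where
  "diag_of n d = mat n n (\<lambda>(i, j). if i = j then d i else 0)"

lemma diag_of_carrier [simp]: "diag_of n d \<in> carrier_mat n n"
  by (simp add: diag_of_def)

lemma diag_of_dim [simp]: "dim_row (diag_of n d) = n" "dim_col (diag_of n d) = n"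
  by (simp_all add: diag_of_def)

lemma diag_of_index [simp]:
  "i < n \<Longrightarrow> j < n \<Longrightarrow> diag_of n d $$ (i, j) = (if i = j then d i else 0)"
  by (simp add: diag_of_def)

lemma diag_of_mult_index:
  assumes "A \<in> carrier_mat n n" "i < n" "j < n"
  shows "(diag_of n d * A) $$ (i, j) = d i * A $$ (i, j)"
    "(A * diag_of n d) $$ (i, j) = A $$ (i, j) * d j"
  using assms by (simp_all add: mult_mat_index_sum[of _ n n _ n] if_distrib
      if_distribR cong: if_cong del: index_mult_mat(1))

lemma diag_of_mult: "diag_of n d * diag_of n e = diag_of n (\<lambda>i. d i * e i)"
  by (rule eq_matI) (auto simp: diag_of_mult_index(1)[of _ n] simp del: index_mult_mat(1))

lemma mat_adjoint_diag_of: "mat_adjoint (diag_of n d) = diag_of n (\<lambda>i. cnj (d i))"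
  by (rule eq_matI) auto

lemma diag_of_one: "diag_of n (\<lambda>_. 1) = 1\<^sub>m n"
  by (rule eq_matI) auto

lemma mtrace_diag_mult:
  assumes "A \<in> carrier_mat n n"
  shows "mtrace (diag_of n d * A) = (\<Sum>i<n. d i * A $$ (i, i))"
  using assms unfolding mtrace_def by (auto simp: diag_of_mult_index simp del: index_mult_mat(1))

section \<open>Unitary matrices\<close>

definition unitary :: "nat \<Rightarrow> complex mat \<Rightarrow> bool" where
  "unitary n U \<longleftrightarrow> U \<in> carrier_mat n n \<and> mat_adjoint U * U = 1\<^sub>m n \<and> U * mat_adjoint U = 1\<^sub>m n"

lemma unitaryD:
  assumes "unitary n U"
  shows "U \<in> carrier_mat n n" "mat_adjoint U \<in> carrier_mat n n"
    "mat_adjoint U * U = 1\<^sub>m n" "U * mat_adjoint U = 1\<^sub>m n"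
  using assms by (auto simp: unitary_def)

text \<open>In finite dimension a left inverse of a square matrix is also a right inverse, so one of
  the two equations suffices.\<close>

lemma unitaryI:
  assumes "U \<in> carrier_mat n n" "mat_adjoint U * U = 1\<^sub>m n"
  shows "unitary n U"
  unfolding unitary_def
  using assms mat_mult_left_right_inverse[OF _ assms(1), of "mat_adjoint U"] by auto

lemma unitary_adjoint: "unitary n U \<Longrightarrow> unitary n (mat_adjoint U)"
  by (auto simp: unitary_def)

lemma unitary_cancel:
  assumes "unitary n U" "A \<in> carrier_mat n n"
  shows "mat_adjoint U * (U * A) = A" "U * (mat_adjoint U * A) = A"
  using unitaryD[OF assms(1)] assms(2)
    assoc_mult_mat[of "mat_adjoint U" n n U n A n] assoc_mult_mat[of U n n "mat_adjoint U" n A n]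
  by simp_all

lemma unitary_mult:
  assumes U: "unitary n U" and V: "unitary n V"
  shows "unitary n (U * V)"
proof (rule unitaryI)
  show "U * V \<in> carrier_mat n n" using unitaryD[OF U] unitaryD[OF V] by auto
  show "mat_adjoint (U * V) * (U * V) = 1\<^sub>m n"
    using unitaryD[OF U] unitaryD[OF V]
    by (simp add: mat_adjoint_mult[of _ n n _ n] assoc_mult_mat[of _ n n _ n _ n] unitary_cancel[OF U])
qed

text \<open>These are the diagonal entries of \<open>U * mat_adjoint U\<close> and
  \<open>mat_adjoint U * U\<close>. They later make the squared moduli of a unitary act as doubly
  stochastic weights.\<close>

lemma unitary_row_col_norm:
  assumes "unitary n U" "i < n"
  shows "(\<Sum>j<n. (cmod (U $$ (i, j)))\<^sup>2) = 1"
    and "(\<Sum>j<n. (cmod (U $$ (j, i)))\<^sup>2) = 1"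
proof -
  note U = unitaryD[OF assms(1)]
  have "complex_of_real (\<Sum>j<n. (cmod (U $$ (i, j)))\<^sup>2) = (U * mat_adjoint U) $$ (i, i)"
    using U(1) assms(2) by (simp add: mult_mat_index_sum[of _ n n _ n] complex_norm_square del: index_mult_mat(1) of_real_power)
  also have "\<dots> = of_real 1" using U assms by simp
  finally show "(\<Sum>j<n. (cmod (U $$ (i, j)))\<^sup>2) = 1" by (simp only: of_real_eq_iff)
  have "complex_of_real (\<Sum>j<n. (cmod (U $$ (j, i)))\<^sup>2) = (mat_adjoint U * U) $$ (i, i)"
    using U(1) assms(2) by (simp add: mult_mat_index_sum[of _ n n _ n] complex_norm_square mult.commute del: index_mult_mat(1) of_real_power)
  also have "\<dots> = of_real 1" using U assms by simp
  finally show "(\<Sum>j<n. (cmod (U $$ (j, i)))\<^sup>2) = 1" by (simp only: of_real_eq_iff)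
qed

text \<open>Used in two ways: with a unitary as a change of basis, and with the real diagonal matrix
  G^(-1/2) to build the outcome operators of the measurement.\<close>

definition conj_by :: "complex mat \<Rightarrow> complex mat \<Rightarrow> complex mat" where
  "conj_by U A = U * A * mat_adjoint U"

lemma conj_by_carrier [simp]:
  "U \<in> carrier_mat n n \<Longrightarrow> A \<in> carrier_mat n n \<Longrightarrow> conj_by U A \<in> carrier_mat n n"
  by (simp add: conj_by_def)

lemma conj_by_mult:
  assumes "unitary n U" "A \<in> carrier_mat n n" "B \<in> carrier_mat n n"
  shows "conj_by U A * conj_by U B = conj_by U (A * B)"
  using unitaryD[OF assms(1)] assms(2,3)
  by (simp add: conj_by_def assoc_mult_mat[of _ n n _ n _ n] unitary_cancel[OF assms(1)])

lemma conj_by_adjoint: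
  assumes "U \<in> carrier_mat n n" "A \<in> carrier_mat n n"
  shows "mat_adjoint (conj_by U A) = conj_by U (mat_adjoint A)"
  using assms by (simp add: conj_by_def mat_adjoint_mult[of _ n n _ n] assoc_mult_mat[of _ n n _ n _ n])

lemma conj_by_conj_by:
  assumes "U \<in> carrier_mat n n" "V \<in> carrier_mat n n" "A \<in> carrier_mat n n"
  shows "conj_by U (conj_by V A) = conj_by (U * V) A"
  using assms by (simp add: conj_by_def mat_adjoint_mult[of _ n n _ n] assoc_mult_mat[of _ n n _ n _ n])

lemma conj_by_adjoint_cancel:
  assumes "unitary n U" "A \<in> carrier_mat n n"
  shows "conj_by (mat_adjoint U) (conj_by U A) = A" "conj_by U (conj_by (mat_adjoint U) A) = A"
  using unitaryD[OF assms(1)] assms(2)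
  by (simp_all add: conj_by_def assoc_mult_mat[of _ n n _ n _ n] unitary_cancel[OF assms(1)])

lemma conj_by_one: "unitary n U \<Longrightarrow> conj_by U (1\<^sub>m n) = 1\<^sub>m n"
  using unitaryD[of n U] by (simp add: conj_by_def)

lemma conj_by_add:
  assumes "U \<in> carrier_mat n n" "A \<in> carrier_mat n n" "B \<in> carrier_mat n n"
  shows "conj_by U (A + B) = conj_by U A + conj_by U B"
  using assms by (simp add: conj_by_def mult_add_distrib_mat[of _ n n] add_mult_distrib_mat[of _ n n _ _ n])

lemma conj_by_minus:
  assumes "U \<in> carrier_mat n n" "A \<in> carrier_mat n n" "B \<in> carrier_mat n n"
  shows "conj_by U (A - B) = conj_by U A - conj_by U B"
  using assms by (simp add: conj_by_def mult_minus_distrib_mat[of _ n n] minus_mult_distrib_mat[of _ n n _ _ n])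

lemma mtrace_conj_by:
  assumes "unitary n U" "A \<in> carrier_mat n n"
  shows "mtrace (conj_by U A) = mtrace A"
  using unitaryD[OF assms(1)] assms(2) mtrace_mult_comm[of "U * A" n n "mat_adjoint U"]
  by (simp add: conj_by_def unitary_cancel[OF assms(1)])

lemma similar_conj_by:
  assumes "unitary n U" "A \<in> carrier_mat n n"
  shows "similar_mat (conj_by U A) A"
  using unitaryD[OF assms(1)] assms(2)
  by (intro similar_matI[of _ _ "U" "mat_adjoint U" n]) (auto simp: conj_by_def)

text \<open>The product A* A is conjugated by the same unitary, and similar matrices share their
  characteristic polynomial, hence their singular values.\<close>

lemma trace_norm_conj_by:
  assumes U: "unitary n U" and A: "A \<in> carrier_mat n n"
  shows "trace_norm (conj_by U A) = trace_norm A"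
proof -
  have "mat_adjoint (conj_by U A) * conj_by U A = conj_by U (mat_adjoint A * A)"
    using A unitaryD[OF U] by (simp add: conj_by_adjoint[of _ n] conj_by_mult[OF U])
  then show ?thesis
    using A char_poly_similar[OF similar_conj_by[OF U, of "mat_adjoint A * A"]]
    by (simp add: trace_norm_def singular_values_def)
qed

text \<open>A* A is diagonal with entries \<open>(l i)\<^sup>2\<close>, its characteristic
  polynomial splits into the corresponding linear factors, and the root of a square is the absolute
  value.\<close>

lemma trace_norm_diag_of:
  "trace_norm (diag_of n (\<lambda>i. of_real (l i))) = (\<Sum>i<n. \<bar>l i\<bar>)"
proof -
  let ?D = "diag_of n (\<lambda>i. of_real ((l i)\<^sup>2))"
  have "mat_adjoint (diag_of n (\<lambda>i. of_real (l i))) * diag_of n (\<lambda>i. of_real (l i)) = ?D"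
    by (simp add: mat_adjoint_diag_of diag_of_mult power2_eq_square)
  moreover have "char_poly ?D = (\<Prod>a\<leftarrow>diag_mat ?D. [:- a, 1:])"
    by (rule char_poly_upper_triangular[of _ n]) auto
  moreover have "proots (\<Prod>a\<leftarrow>xs. [:- a, 1:]) = mset xs" for xs :: "complex list"
    proof (induction xs)
    case (Cons x xs)
    \<comment> \<open>\<open>proots\<close> turns products into sums only for nonzero polynomials;
      monicity provides this.\<close>
    have "monic (\<Prod>a\<leftarrow>xs. [:- a, 1:])" by (rule monic_prod_list) auto
    then have "(\<Prod>a\<leftarrow>xs. [:- a, 1:]) \<noteq> 0" by auto
    then show ?case
      using Cons proots_mult[of "[:- x, 1:]" "\<Prod>a\<leftarrow>xs. [:- a, 1:]"]
      by (simp del: mult_pCons_left)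
  qed simp
  moreover have "diag_mat ?D = map (\<lambda>i. of_real ((l i)\<^sup>2)) [0..<n]"
    by (auto simp: diag_mat_def)
  ultimately have "proots (char_poly ?D) = mset (map (\<lambda>i. of_real ((l i)\<^sup>2)) [0..<n])"
      "mat_adjoint (diag_of n (\<lambda>i. of_real (l i))) * diag_of n (\<lambda>i. of_real (l i)) = ?D"
    by (simp_all only:)
  then have "trace_norm (diag_of n (\<lambda>i. of_real (l i))) = sum_mset (mset (map (\<lambda>i. \<bar>l i\<bar>) [0..<n]))"
    unfolding trace_norm_def singular_values_def by (simp only: flip: mset_map) (simp add: comp_def)
  also have "\<dots> = (\<Sum>i<n. \<bar>l i\<bar>)"
    by (simp add: lessThan_atLeast0 flip: sum_unfold_sum_mset)
  finally show ?thesis .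
qed

lemma conj_by_diag_index:
  assumes "U \<in> carrier_mat n n" "i < n" "j < n"
  shows "conj_by U (diag_of n d) $$ (i, j) = (\<Sum>k<n. U $$ (i, k) * d k * cnj (U $$ (j, k)))"
  using assms
  unfolding conj_by_def by (subst mult_mat_index_sum[of _ n n _ n])
    (auto simp: diag_of_mult_index(2) simp del: index_mult_mat(1) intro!: sum.cong)

subsection \<open>The spectral theorem for Hermitian matrices\<close>

text \<open>Complete \<open>v\<close> to a basis, orthogonalise with \<open>v\<close> in first
  position, and normalise the columns. The scalar \<open>c\<close> is the inverse length of
  \<open>v\<close>.\<close>

lemma orthonormal_extension:
  fixes v :: "complex vec"
  assumes v: "v \<in> carrier_vec n" and v0: "v \<noteq> 0\<^sub>v n" and n: "0 < n"
  obtains W c where "unitary n W" "\<And>i. i < n \<Longrightarrow> W $$ (i, 0) = c * v $ i"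
proof -
  interpret cof_vec_space n "TYPE(complex)" .
  define b where "b = basis_completion v"
  define ws where "ws = gram_schmidt n b"
  from basis_completion[OF v v0, folded b_def]
  have dist_b: "distinct b" and indep: "\<not> lin_dep (set b)" and b: "set b \<subseteq> carrier_vec n"
    and hdb: "hd b = v" and len_b: "length b = n" by auto
  from hdb len_b n obtain vs where bv: "b = v # vs" by (cases b) auto
  from gram_schmidt_result[OF b dist_b indep refl, folded ws_def]
  have ws: "set ws \<subseteq> carrier_vec n" "corthogonal ws" "length ws = n" by (auto simp: len_b)
  from gram_schmidt_hd[OF v, of vs, folded bv] have "hd ws = v" unfolding ws_def .
  then have ws0: "ws ! 0 = v" using ws(3) n by (cases ws) auto
  \<comment> \<open>Gram-Schmidt here keeps \<open>v\<close> itself as first vector and does not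
    normalise; \<open>N j\<close> is the length of the j-th vector.\<close>
  define N where "N j = sqrt (Re (ws ! j \<bullet>c ws ! j))" for j
  define W where "W = mat n n (\<lambda>(i, j). ws ! j $ i / of_real (N j))"
  have wsc: "ws ! j \<in> carrier_vec n" if "j < n" for j using ws that by auto
  have ip: "ws ! j \<bullet>c ws ! i = (\<Sum>k<n. ws ! j $ k * cnj (ws ! i $ k))" if "i < n" "j < n" for i j
    using wsc[OF that(1)] wsc[OF that(2)] by (auto simp: scalar_prod_def lessThan_atLeast0)
  have N: "of_real (N j) * of_real (N j) = ws ! j \<bullet>c ws ! j" "N j \<noteq> 0" if j: "j < n" for j
  proof -
    have eq: "ws ! j \<bullet>c ws ! j = of_real (\<Sum>k<n. (cmod (ws ! j $ k))\<^sup>2)"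
      unfolding ip[OF j j] by (simp add: complex_norm_square del: of_real_power)
    then have re: "Re (ws ! j \<bullet>c ws ! j) = (\<Sum>k<n. (cmod (ws ! j $ k))\<^sup>2)"
      by (simp del: of_real_sum)
    have "Re (ws ! j \<bullet>c ws ! j) \<ge> 0" unfolding re by (intro sum_nonneg) auto
    then have "N j * N j = Re (ws ! j \<bullet>c ws ! j)" by (simp add: N_def)
    then show *: "of_real (N j) * of_real (N j) = ws ! j \<bullet>c ws ! j"
      using eq re by (metis of_real_mult)
    have "ws ! j \<bullet>c ws ! j \<noteq> 0" using corthogonalD[OF ws(2), of j j] ws(3) j by auto
    then show "N j \<noteq> 0" using * by auto
  qed
  have "unitary n W"
  proof (rule unitaryI)
    show W: "W \<in> carrier_mat n n" by (simp add: W_def)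
    show "mat_adjoint W * W = 1\<^sub>m n"
    proof (rule eq_matI)
      fix i j assume "i < dim_row (1\<^sub>m n)" "j < dim_col (1\<^sub>m n)"
      then have ij: "i < n" "j < n" by auto
      have "(mat_adjoint W * W) $$ (i, j) = (\<Sum>k<n. ws ! j $ k * cnj (ws ! i $ k) / (of_real (N i) * of_real (N j)))"
        using W ij by (subst mult_mat_index_sum[of _ n n _ n]) (auto simp: W_def intro!: sum.cong)
      also have "\<dots> = (ws ! j \<bullet>c ws ! i) / (of_real (N i) * of_real (N j))"
        by (simp add: ip[OF ij] sum_divide_distrib)
      also have "\<dots> = 1\<^sub>m n $$ (i, j)"
        using ij N[of i] corthogonalD[OF ws(2), of j i] ws(3) by (cases "i = j") auto
      finally show "(mat_adjoint W * W) $$ (i, j) = 1\<^sub>m n $$ (i, j)" .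
    qed (use W in auto)
  qed
  moreover have "W $$ (i, 0) = 1 / of_real (N 0) * v $ i" if "i < n" for i
    using that n by (simp add: W_def ws0)
  ultimately show ?thesis using that by blast
qed

text \<open>Over the complex numbers \<open>A\<close> has an eigenvector. Once it spans the first
  column of a unitary \<open>W\<close>, the first column of W* A W is a multiple of the first unit
  vector.\<close>

lemma hermitian_deflation:
  assumes A: "A \<in> carrier_mat (Suc m) (Suc m)" and herm: "mat_adjoint A = A"
  obtains W where "unitary (Suc m) W"
    "\<And>i. i < m \<Longrightarrow> conj_by (mat_adjoint W) A $$ (Suc i, 0) = 0"
proof -
  let ?n = "Suc m"
  from char_poly_factorized[OF A] obtain as
    where "char_poly A = (\<Prod>a\<leftarrow>as. [:- a, 1:])" "length as = ?n" by auto
  then obtain e where "poly (char_poly A) e = 0" by (cases as) auto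
  then obtain v where "eigenvector A v e"
    using eigenvalue_root_char_poly[OF A] unfolding eigenvalue_def by auto
  then have v: "v \<in> carrier_vec ?n" "v \<noteq> 0\<^sub>v ?n" "A *\<^sub>v v = e \<cdot>\<^sub>v v"
    using A unfolding eigenvector_def by auto
  obtain W c where W: "unitary ?n W" and W0: "\<And>i. i < ?n \<Longrightarrow> W $$ (i, 0) = c * v $ i"
    using orthonormal_extension[OF v(1,2)] by auto
  note U = unitaryD[OF W]
  have AW: "(A * W) $$ (k, 0) = e * W $$ (k, 0)" if "k < ?n" for k
  proof -
    have "(A * W) $$ (k, 0) = (\<Sum>l<?n. A $$ (k, l) * (c * v $ l))"
      using A U that by (simp add: mult_mat_index_sum[of _ ?n ?n _ ?n] W0 del: index_mult_mat(1) sum.lessThan_Suc)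
    also have "\<dots> = c * (\<Sum>l<?n. A $$ (k, l) * v $ l)"
      by (simp add: sum_distrib_left mult_ac del: sum.lessThan_Suc)
    also have "\<dots> = c * (A *\<^sub>v v) $ k"
      using A v that mult_mat_vec_index_sum[of A ?n ?n v k] by simp
    also have "\<dots> = e * W $$ (k, 0)" using v that W0 by auto
    finally show ?thesis .
  qed
  \<comment> \<open>By \<open>AW\<close>, these entries are \<open>e\<close> times entries of W* W =
    1 below the diagonal.\<close>
  have "conj_by (mat_adjoint W) A $$ (Suc i, 0) = 0" if "i < m" for i
  proof -
    have "conj_by (mat_adjoint W) A $$ (Suc i, 0) = (mat_adjoint W * (A * W)) $$ (Suc i, 0)"
      using A U by (simp add: conj_by_def assoc_mult_mat[of _ ?n ?n _ ?n _ ?n])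
    also have "\<dots> = (\<Sum>k<?n. mat_adjoint W $$ (Suc i, k) * (e * W $$ (k, 0)))"
      using A U that by (subst mult_mat_index_sum[of _ ?n ?n _ ?n])
        (auto simp: AW simp del: index_mult_mat(1) sum.lessThan_Suc intro!: sum.cong)
    also have "\<dots> = e * (mat_adjoint W * W) $$ (Suc i, 0)"
      using U(1,2) that by (subst mult_mat_index_sum[of _ ?n ?n _ ?n])
        (auto simp: sum_distrib_left mult_ac simp del: sum.lessThan_Suc mat_adjoint_index)
    also have "\<dots> = 0" using U that by simp
    finally show ?thesis .
  qed
  with W show ?thesis using that by blast
qed

text \<open>Induction on the dimension: after deflation, Hermitian symmetry also clears the first
  row, leaving a 1x1 block and a smaller Hermitian block \<open>C\<close>. The eigenvalues are real
  because Hermitian matrices have real diagonal entries.\<close>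

lemma hermitian_spectral:
  assumes "A \<in> carrier_mat n n" "mat_adjoint A = A"
  obtains U l where "unitary n U" "A = conj_by U (diag_of n (\<lambda>i. complex_of_real (l i)))"
proof -
  have "\<exists>U l. unitary n U \<and> A = conj_by U (diag_of n (\<lambda>i. complex_of_real (l i)))"
    using assms
  proof (induction n arbitrary: A)
    case 0
    then show ?case
      by (intro exI[of _ "1\<^sub>m 0"] exI[of _ "\<lambda>_. 0"])
        (auto intro!: unitaryI eq_matI simp: conj_by_def)
  next
    case (Suc m)
    let ?n = "Suc m"
    from hermitian_deflation[OF Suc.prems] obtain W where W: "unitary ?n W"
      and B0: "\<And>i. i < m \<Longrightarrow> conj_by (mat_adjoint W) A $$ (Suc i, 0) = 0" by blast
    note UW = unitaryD[OF W]
    define B where "B = conj_by (mat_adjoint W) A"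
    have B: "B \<in> carrier_mat ?n ?n" using UW Suc.prems by (simp add: B_def)
    have hB: "mat_adjoint B = B"
      using UW Suc.prems by (simp add: B_def conj_by_adjoint[of _ ?n])
    have sB: "B $$ (j, i) = cnj (B $$ (i, j))" if "i < ?n" "j < ?n" for i j
      using mat_adjoint_index[of j B i] B that hB by auto
    define C where "C = mat m m (\<lambda>(i, j). B $$ (Suc i, Suc j))"
    have "C \<in> carrier_mat m m" "mat_adjoint C = C"
      by (auto simp: C_def sB[symmetric] intro!: eq_matI)
    with Suc.IH obtain V l where V: "unitary m V"
      and C: "C = conj_by V (diag_of m (\<lambda>i. complex_of_real (l i)))" by blast
    note UV = unitaryD[OF V]
    \<comment> \<open>\<open>V'\<close> is the block sum of the 1x1 identity and \<open>V\<close>;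
      it diagonalises \<open>C\<close> without touching the first coordinate.\<close>
    define V' where "V' = mat ?n ?n (\<lambda>(i, j). case (i, j) of (0, 0) \<Rightarrow> 1
      | (Suc i, Suc j) \<Rightarrow> V $$ (i, j) | _ \<Rightarrow> 0)"
    have V'i: "V' $$ (0, 0) = 1" "\<And>i. i < m \<Longrightarrow> V' $$ (0, Suc i) = 0"
        "\<And>i. i < m \<Longrightarrow> V' $$ (Suc i, 0) = 0"
        "\<And>i j. i < m \<Longrightarrow> j < m \<Longrightarrow> V' $$ (Suc i, Suc j) = V $$ (i, j)"
      by (simp_all add: V'_def)
    have V'c: "V' \<in> carrier_mat ?n ?n" by (simp add: V'_def)
    have V': "unitary ?n V'"
    proof (rule unitaryI[OF V'c], rule eq_matI)
      fix i j assume "i < dim_row (1\<^sub>m ?n)" "j < dim_col (1\<^sub>m ?n)"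
      then have ij: "i < ?n" "j < ?n" by auto
      have "(mat_adjoint V' * V') $$ (i, j) = (\<Sum>k<?n. cnj (V' $$ (k, i)) * V' $$ (k, j))"
        using V'c ij by (subst mult_mat_index_sum[of _ ?n ?n _ ?n]) auto
      moreover have "(\<Sum>k<m. cnj (V $$ (k, i')) * V $$ (k, j')) = (if i' = j' then 1 else 0)"
        if "i' < m" "j' < m" for i' j'
      proof -
        have "(\<Sum>k<m. cnj (V $$ (k, i')) * V $$ (k, j')) = (mat_adjoint V * V) $$ (i', j')"
          using UV(1) that by (subst mult_mat_index_sum[of _ m m _ m]) auto
        then show ?thesis using UV that by simp
      qed
      ultimately show "(mat_adjoint V' * V') $$ (i, j) = 1\<^sub>m ?n $$ (i, j)"
        using ij by (cases i; cases j)
          (auto simp: sum.lessThan_Suc_shift V'i simp del: sum.lessThan_Suc)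
    qed (use V'c in auto)
    \<comment> \<open>The eigenvalue split off comes first, followed by those of
      \<open>C\<close>.\<close>
    define l' where "l' = case_nat (Re (B $$ (0, 0))) l"
    have "B = conj_by V' (diag_of ?n (\<lambda>i. complex_of_real (l' i)))"
    proof (rule eq_matI)
      fix i j
      assume "i < dim_row (conj_by V' (diag_of ?n (\<lambda>i. complex_of_real (l' i))))"
        "j < dim_col (conj_by V' (diag_of ?n (\<lambda>i. complex_of_real (l' i))))"
      then have ij: "i < ?n" "j < ?n" using V'c by (auto simp: conj_by_def)
      have 1: "conj_by V' (diag_of ?n (\<lambda>i. complex_of_real (l' i))) $$ (i, j)
          = (\<Sum>k<?n. V' $$ (i, k) * of_real (l' k) * cnj (V' $$ (j, k)))"
        using V'c ij by (rule conj_by_diag_index)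
      have 2: "(\<Sum>k<m. V $$ (i', k) * of_real (l k) * cnj (V $$ (j', k))) = B $$ (Suc i', Suc j')"
        if "i' < m" "j' < m" for i' j'
        using arg_cong[OF C, of "\<lambda>M. M $$ (i', j')"] conj_by_diag_index[OF UV(1) that] that
        by (simp add: C_def)
      have "B $$ (0, Suc i') = 0" "B $$ (Suc i', 0) = 0" if "i' < m" for i'
        using sB[of "Suc i'" 0] B0[OF that] that by (auto simp: B_def)
      moreover have "B $$ (0, 0) = of_real (Re (B $$ (0, 0)))"
        using sB[of 0 0] by (simp add: complex_eq_iff)
      ultimately show "B $$ (i, j) = conj_by V' (diag_of ?n (\<lambda>i. complex_of_real (l' i))) $$ (i, j)"
        unfolding 1 using ij 2 by (cases i; cases j)
          (auto simp: sum.lessThan_Suc_shift V'i l'_def simp del: sum.lessThan_Suc)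
    qed (use B V'c in \<open>auto simp: conj_by_def\<close>)
    then have "A = conj_by (W * V') (diag_of ?n (\<lambda>i. complex_of_real (l' i)))"
      using conj_by_adjoint_cancel(2)[OF W Suc.prems(1)] UW V'c
      by (simp add: B_def conj_by_conj_by[of _ ?n])
    then show ?case using unitary_mult[OF W V'] by blast
  qed
  then show ?thesis using that by blast
qed

subsection \<open>Positive semidefinite matrices\<close>

lemma psd_carrier: "psd n A \<Longrightarrow> A \<in> carrier_mat n n"
  by (simp add: psd_def)

lemma quadratic_form_sum:
  assumes "A \<in> carrier_mat n n" "v \<in> carrier_vec n"
  shows "(A *\<^sub>v v) \<bullet>c v = (\<Sum>i<n. (\<Sum>j<n. A $$ (i, j) * v $ j) * cnj (v $ i))"
  using assms by (auto simp: scalar_prod_def lessThan_atLeast0)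

text \<open>The quadratic form evaluated at the vector with \<open>s\<close> at position
  \<open>i\<close>, \<open>t\<close> at position \<open>j\<close> and 0 elsewhere. Well-chosen
  \<open>s\<close> and \<open>t\<close> then yield entrywise information.\<close>

lemma psd_two_dim:
  assumes A: "psd n A" and ij: "i < n" "j < n" "i \<noteq> j"
  shows "0 \<le> A $$ (i, i) * s * cnj s + A $$ (j, j) * t * cnj t
             + A $$ (i, j) * t * cnj s + A $$ (j, i) * s * cnj t"
proof -
  define w where "w k = (if k = i then s else 0) + (if k = j then t else 0)" for k
  have w: "(\<Sum>k<n. f k * w k) = f i * s + f j * t" for f
  proof -
    have "(\<Sum>k<n. f k * w k) = (\<Sum>k<n. if k = i then f i * s else 0) + (\<Sum>k<n. if k = j then f j * t else 0)"
      unfolding sum.distrib[symmetric] by (intro sum.cong) (auto simp: w_def distrib_left)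
    then show ?thesis using ij by simp
  qed
  have w': "(\<Sum>k<n. f k * cnj (w k)) = f i * cnj s + f j * cnj t" for f
    using arg_cong[OF w[of "\<lambda>k. cnj (f k)"], of cnj] by simp
  have "0 \<le> (A *\<^sub>v vec n w) \<bullet>c vec n w" using A by (auto simp: psd_def)
  also have "\<dots> = (\<Sum>k<n. (\<Sum>l<n. A $$ (k, l) * w l) * cnj (w k))"
    by (subst quadratic_form_sum[OF psd_carrier[OF A]]) auto
  finally have "0 \<le> (\<Sum>k<n. (\<Sum>l<n. A $$ (k, l) * w l) * cnj (w k))" .
  then show ?thesis unfolding w w' by (simp add: algebra_simps)
qed

lemma psd_diag_nonneg:
  assumes A: "psd n A" and i: "i < n"
  shows "0 \<le> A $$ (i, i)"
proof -
  have "0 \<le> (A *\<^sub>v unit_vec n i) \<bullet>c unit_vec n i" using A by (auto simp: psd_def)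
  also have "\<dots> = A $$ (i, i)"
    using i by (subst quadratic_form_sum[OF psd_carrier[OF A]])
      (auto simp: unit_vec_def if_distrib cong: if_cong)
  finally show ?thesis .
qed

lemma psd_symmetric_entry:
  assumes A: "psd n A" and ij: "i < n" "j < n"
  shows "A $$ (j, i) = cnj (A $$ (i, j))"
proof (cases "i = j")
  case True
  then show ?thesis using psd_diag_nonneg[OF A ij(1)] by (simp add: less_eq_complex_def complex_eq_iff)
next
  case False
  have "Im (A $$ (i, i)) = 0" "Im (A $$ (j, j)) = 0"
    using psd_diag_nonneg[OF A] ij by (auto simp: less_eq_complex_def)
  \<comment> \<open>The form is real at (1, 1) and at (1, i): the first fixes the imaginary parts of
    the two entries, the second their real parts.\<close>
  then show ?thesis
    using psd_two_dim[OF A ij False, of 1 1] psd_two_dim[OF A ij False, of 1 \<i>]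
    by (auto simp: less_eq_complex_def complex_eq_iff)
qed

lemma psd_hermitian: "psd n A \<Longrightarrow> mat_adjoint A = A"
  using psd_carrier[of n A]
  by (intro eq_matI) (auto intro: psd_symmetric_entry[symmetric])

text \<open>With a zero at position (i, i), the form has no quadratic term in \<open>s\<close>, so a
  nonzero cross term could push it below 0. This lets the kernel of G be handled entrywise
  later.\<close>

lemma psd_zero_diag:
  assumes A: "psd n A" and ij: "i < n" "j < n" and 0: "A $$ (i, i) = 0"
  shows "A $$ (i, j) = 0"
proof (cases "i = j")
  case False
  define z where "z = A $$ (i, j)"
  have *: "A $$ (j, i) = cnj z" using psd_symmetric_entry[OF A ij] by (simp add: z_def)
  define r where "r = Re (A $$ (j, j))"
  have r: "A $$ (j, j) = of_real r" "r \<ge> 0"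
    using psd_diag_nonneg[OF A ij(2)] by (auto simp: r_def less_eq_complex_def complex_eq_iff)
  have cmod: "(cmod z)\<^sup>2 = Re z * Re z + Im z * Im z" 
    unfolding cmod_power2 by (simp add: power2_eq_square)
  \<comment> \<open>Taking s = r + 1 makes the two cross terms, of total -2(r + 1)|z|^2, outweigh
    the term r|z|^2.\<close>
  have "0 \<le> r * (cmod z)\<^sup>2 - 2 * (r + 1) * (cmod z)\<^sup>2"
    using psd_two_dim[OF A ij False, of "of_real (r + 1)" "- cnj z"]
    by (simp add: less_eq_complex_def 0 * r(1) flip: z_def)
      (simp add: cmod algebra_simps)
  then have "(r + 2) * (cmod z)\<^sup>2 \<le> 0" by (simp add: algebra_simps)
  moreover have "0 < (r + 2) * (cmod z)\<^sup>2" if "z \<noteq> 0" using r(2) that by simp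
  ultimately have "z = 0" by force
  then show ?thesis by (simp add: z_def)
qed (use 0 in simp)

text \<open>Moving \<open>U\<close> across the inner product gives <U A U* v, v> = <A w, w> with w =
  U* v. This covers basis changes as well as the possibly singular diagonal factor of the
  measurement.\<close>

lemma psd_conj_by:
  assumes A: "psd n A" and U: "U \<in> carrier_mat n n"
  shows "psd n (conj_by U A)"
  unfolding psd_def
proof (intro conjI ballI)
  have Ac: "A \<in> carrier_mat n n" by (rule psd_carrier[OF A])
  show "conj_by U A \<in> carrier_mat n n" using Ac U by simp
  fix v :: "complex vec" assume v: "v \<in> carrier_vec n"
  define w where "w = mat_adjoint U *\<^sub>v v"
  have w: "w \<in> carrier_vec n" unfolding w_def using U v by (intro mult_mat_vec_carrier) auto
  have eq: "conj_by U A *\<^sub>v v = U *\<^sub>v (A *\<^sub>v w)"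
    using Ac U v w by (simp add: conj_by_def assoc_mult_mat_vec[of _ n n _ n] flip: w_def)
  have Aw: "A *\<^sub>v w \<in> carrier_vec n" using Ac w by (rule mult_mat_vec_carrier)
  have "(U *\<^sub>v x) \<bullet>c v = x \<bullet>c w" if x: "x \<in> carrier_vec n" for x
  proof -
    have "(U *\<^sub>v x) \<bullet>c v = (\<Sum>i<n. (U *\<^sub>v x) $ i * cnj (v $ i))"
      using U x v by (auto simp: scalar_prod_def lessThan_atLeast0)
    also have "\<dots> = (\<Sum>i<n. (\<Sum>j<n. U $$ (i, j) * x $ j) * cnj (v $ i))"
      using U x by (intro sum.cong) (simp_all add: mult_mat_vec_index_sum[of _ n n] del: index_mult_mat_vec)
    also have "\<dots> = (\<Sum>j<n. x $ j * (\<Sum>i<n. U $$ (i, j) * cnj (v $ i)))"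
      by (simp add: sum_distrib_right sum_distrib_left, subst sum.swap) (simp add: mult_ac)
    also have "\<dots> = (\<Sum>j<n. x $ j * cnj (w $ j))"
      using U v by (intro sum.cong) (simp_all add: w_def mult_mat_vec_index_sum[of _ n n] del: index_mult_mat_vec)
    also have "\<dots> = x \<bullet>c w"
      using x w by (auto simp: scalar_prod_def lessThan_atLeast0)
    finally show ?thesis .
  qed
  then show "0 \<le> (conj_by U A *\<^sub>v v) \<bullet>c v"
    unfolding eq using Aw A w by (auto simp: psd_def)
qed

lemma psd_add:
  assumes A: "psd n A" and B: "psd n B"
  shows "psd n (A + B)"
  unfolding psd_def
proof (intro conjI ballI)
  note c = psd_carrier[OF A] psd_carrier[OF B]
  show "A + B \<in> carrier_mat n n" using c by simp
  fix v :: "complex vec" assume v: "v \<in> carrier_vec n"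
  have "((A + B) *\<^sub>v v) \<bullet>c v = (A *\<^sub>v v) \<bullet>c v + (B *\<^sub>v v) \<bullet>c v"
    using c v by (simp add: add_mult_distrib_mat_vec[of _ n n] add_scalar_prod_distrib[of _ n])
  then show "0 \<le> ((A + B) *\<^sub>v v) \<bullet>c v" using A B v by (auto simp: psd_def)
qed

lemma psd_diag_of:
  assumes "\<And>i. i < n \<Longrightarrow> 0 \<le> d i"
  shows "psd n (diag_of n d)"
  unfolding psd_def
proof (intro conjI ballI)
  fix v :: "complex vec" assume v: "v \<in> carrier_vec n"
  have "(diag_of n d *\<^sub>v v) \<bullet>c v = (\<Sum>i<n. d i * (v $ i * cnj (v $ i)))"
    using v by (subst quadratic_form_sum) (auto simp: if_distrib if_distribR mult_ac cong: if_cong intro!: sum.cong)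
  also have "\<dots> \<ge> 0" using assms
    by (intro sum_nonneg mult_nonneg_nonneg[of "d _"]) (auto simp: less_eq_complex_def)
  finally show "0 \<le> (diag_of n d *\<^sub>v v) \<bullet>c v" .
qed simp

lemma psd_one: "psd n (1\<^sub>m n)"
  unfolding diag_of_one[symmetric] by (rule psd_diag_of) (simp add: less_eq_complex_def)

lemma psd_zero: "psd n (0\<^sub>m n n)"
proof -
  have "0\<^sub>m n n = diag_of n (\<lambda>_. 0)" by (rule eq_matI) auto
  then show ?thesis using psd_diag_of[of n "\<lambda>_. 0"] by simp
qed

subsection \<open>Trace norm and two-state discrimination\<close>

lemma hermitian_diff:
  assumes "psd n A" "psd n B"
  shows "A - B \<in> carrier_mat n n" "mat_adjoint (A - B) = A - B"
proof -
  note c = psd_carrier[OF assms(1)] psd_carrier[OF assms(2)]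
  show "A - B \<in> carrier_mat n n" using c by (intro minus_carrier_mat)
  show "mat_adjoint (A - B) = A - B"
    using c psd_symmetric_entry[OF assms(1), symmetric] psd_symmetric_entry[OF assms(2), symmetric]
    by (intro eq_matI) (auto simp: conjugate_complex_def)
qed

lemma trace_norm_spectral:
  assumes "unitary n U"
  shows "trace_norm (conj_by U (diag_of n (\<lambda>i. of_real (l i)))) = (\<Sum>i<n. \<bar>l i\<bar>)"
  by (simp add: trace_norm_conj_by[OF assms] trace_norm_diag_of)

text \<open>In the eigenbasis of one factor only the diagonal of the other contributes, so trace
  estimates become estimates of real sums over eigenvalues.\<close>

lemma mtrace_spectral_mult:
  assumes U: "unitary n U" and M: "M \<in> carrier_mat n n"
  shows "mtrace (conj_by U (diag_of n d) * M) = (\<Sum>k<n. d k * conj_by (mat_adjoint U) M $$ (k, k))"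
proof -
  have M': "conj_by (mat_adjoint U) M \<in> carrier_mat n n" using unitaryD[OF U] M by simp
  have "conj_by U (diag_of n d) * M = conj_by U (diag_of n d * conj_by (mat_adjoint U) M)"
    using conj_by_mult[OF U _ M', of "diag_of n d"] conj_by_adjoint_cancel(2)[OF U M] by simp
  then show ?thesis using M' by (simp add: mtrace_conj_by[OF U] mtrace_diag_mult)
qed

text \<open>\<open>W\<close> is the sign of \<open>X\<close>, taken in its eigenbasis. This writes
  the trace norm as a trace that is linear in the entries of \<open>X\<close>, ready for
  Cauchy-Schwarz.\<close>

lemma trace_norm_attained:
  assumes "X \<in> carrier_mat n n" "mat_adjoint X = X"
  obtains W where "unitary n W" "trace_norm X = Re (mtrace (X * W))"
proof -
  obtain U l where U: "unitary n U" and X: "X = conj_by U (diag_of n (\<lambda>i. complex_of_real (l i)))"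
    using hermitian_spectral[OF assms] by blast
  note Uc = unitaryD[OF U]
  \<comment> \<open>The sign of 0 is set to 1, since \<open>W\<close> could not be unitary with a 0
    on its spectrum.\<close>
  define s where "s i = (if l i \<ge> 0 then 1 else - 1 :: complex)" for i
  define W where "W = conj_by U (diag_of n s)"
  have s: "(\<lambda>i. cnj (s i) * s i) = (\<lambda>_. 1)" "(\<lambda>i. of_real (l i) * s i) = (\<lambda>i. of_real \<bar>l i\<bar>)"
    by (auto simp: s_def)
  have "mat_adjoint W * W = 1\<^sub>m n"
    using Uc by (simp add: W_def conj_by_adjoint[of _ n] conj_by_mult[OF U] mat_adjoint_diag_of
        diag_of_mult s diag_of_one conj_by_one[OF U])
  then have "unitary n W" using Uc by (intro unitaryI) (simp_all add: W_def)
  moreover have "mtrace (X * W) = of_real (\<Sum>i<n. \<bar>l i\<bar>)"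
    by (simp add: X W_def conj_by_mult[OF U] diag_of_mult s mtrace_conj_by[OF U]) (simp add: mtrace_def)
  ultimately show ?thesis
    using that trace_norm_spectral[OF U, of l] by (simp add: X del: of_real_sum)
qed

section \<open>Density matrices and Helstrom's bound\<close>

lemma density_psd: "density_matrix n \<rho> \<Longrightarrow> psd n \<rho>"
  by (simp add: density_matrix_def)

lemma density_conj_by:
  assumes "density_matrix n \<rho>" "unitary n U"
  shows "density_matrix n (conj_by U \<rho>)"
  using assms psd_conj_by[of n \<rho> U] mtrace_conj_by[OF assms(2) psd_carrier, of \<rho>] unitaryD(1)[of n U]
  by (simp add: density_matrix_def)

lemma density_diag:
  assumes "density_matrix n \<rho>"
  shows "k < n \<Longrightarrow> 0 \<le> Re (\<rho> $$ (k, k))" "(\<Sum>k<n. Re (\<rho> $$ (k, k))) = 1"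
proof -
  show "0 \<le> Re (\<rho> $$ (k, k))" if "k < n"
    using psd_diag_nonneg[OF density_psd[OF assms] that] by (simp add: less_eq_complex_def)
  have "mtrace \<rho> = 1" "\<rho> \<in> carrier_mat n n"
    using assms psd_carrier by (auto simp: density_matrix_def)
  then show "(\<Sum>k<n. Re (\<rho> $$ (k, k))) = 1" by (auto simp: mtrace_def simp flip: Re_sum)
qed

text \<open>The eigenvalues of a density matrix are nonnegative with sum 1, hence at most 1. The
  bound serves to show that the success values are bounded above.\<close>

lemma density_success_le:
  assumes \<rho>: "density_matrix n \<rho>" and M: "psd n M"
  shows "Re (mtrace (\<rho> * M)) \<le> Re (mtrace M)"
proof -
  note c = psd_carrier[OF density_psd[OF \<rho>]] psd_carrier[OF M]
  obtain U l where U: "unitary n U" and X: "\<rho> = conj_by U (diag_of n (\<lambda>i. complex_of_real (l i)))"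
    using hermitian_spectral[OF c(1) psd_hermitian[OF density_psd[OF \<rho>]]] by blast
  note Uc = unitaryD[OF U]
  define m where "m k = conj_by (mat_adjoint U) M $$ (k, k)" for k
  have m: "0 \<le> Re (m k)" if "k < n" for k
    using psd_diag_nonneg[OF psd_conj_by[OF M Uc(2)] that] by (simp add: m_def less_eq_complex_def)
  \<comment> \<open>The diagonal matrix of eigenvalues is a unitary conjugate of
    \<open>\<rho>\<close>, so facts about diagonals of density matrices apply to the
    eigenvalues.\<close>
  have "density_matrix n (diag_of n (\<lambda>i. complex_of_real (l i)))"
    using density_conj_by[OF \<rho> unitary_adjoint[OF U]] conj_by_adjoint_cancel(1)[OF U, of "diag_of n (\<lambda>i. complex_of_real (l i))"]
    by (simp add: X)
  from density_diag[OF this] have l: "\<And>k. k < n \<Longrightarrow> 0 \<le> l k" and sum: "(\<Sum>k<n. l k) = 1" by auto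
  have l1: "l k \<le> 1" if "k < n" for k
    unfolding sum[symmetric] using l that by (intro member_le_sum) auto
  have "Re (mtrace (\<rho> * M)) = (\<Sum>k<n. l k * Re (m k))"
    unfolding X mtrace_spectral_mult[OF U c(2)] by (simp add: m_def)
  also have "\<dots> \<le> (\<Sum>k<n. Re (m k))"
    using l l1 m by (intro sum_mono) (simp add: mult_left_le_one_le)
  also have "\<dots> = Re (mtrace (conj_by (mat_adjoint U) M))"
    using c Uc by (simp add: mtrace_def m_def conj_by_def)
  also have "\<dots> = Re (mtrace M)"
    by (simp add: mtrace_conj_by[OF unitary_adjoint[OF U] c(2)])
  finally show ?thesis .
qed

text \<open>In the eigenbasis of the difference, each eigenvalue is r - s for diagonal entries r, s
  of the two states. Then |r - s| <= r + s, and these sums total 2.\<close>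

lemma trace_distance_le_1:
  assumes \<rho>: "density_matrix n \<rho>" and \<sigma>: "density_matrix n \<sigma>"
  shows "trace_distance \<rho> \<sigma> \<le> 1"
proof -
  note c = psd_carrier[OF density_psd[OF \<rho>]] psd_carrier[OF density_psd[OF \<sigma>]]
  obtain U l where U: "unitary n U" and X: "\<rho> - \<sigma> = conj_by U (diag_of n (\<lambda>i. complex_of_real (l i)))"
    using hermitian_spectral[OF hermitian_diff[OF density_psd[OF \<rho>] density_psd[OF \<sigma>]]] by blast
  note Uc = unitaryD[OF U]
  let ?r = "conj_by (mat_adjoint U) \<rho>" and ?s = "conj_by (mat_adjoint U) \<sigma>"
  have "diag_of n (\<lambda>i. complex_of_real (l i)) = ?r - ?s"
    using conj_by_minus[OF Uc(2) c] conj_by_adjoint_cancel(1)[OF U, of "diag_of n (\<lambda>i. complex_of_real (l i))"]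
    by (simp add: X)
  then have "complex_of_real (l k) = (?r - ?s) $$ (k, k)" if "k < n" for k
    using that diag_of_index[of k n k "\<lambda>i. complex_of_real (l i)"] by simp
  then have "l k = Re (?r $$ (k, k)) - Re (?s $$ (k, k))" if "k < n" for k
    using that c Uc by (metis Re_complex_of_real carrier_matD conj_by_carrier index_minus_mat(1) minus_complex.sel(1))
  then have "(\<Sum>k<n. \<bar>l k\<bar>) \<le> (\<Sum>k<n. Re (?r $$ (k, k)) + Re (?s $$ (k, k)))"
    using density_diag(1)[OF density_conj_by[OF \<rho> unitary_adjoint[OF U]]]
      density_diag(1)[OF density_conj_by[OF \<sigma> unitary_adjoint[OF U]]]
    by (intro sum_mono) (force simp: abs_le_iff)
  also have "\<dots> = 2"
    using density_diag(2)[OF density_conj_by[OF \<rho> unitary_adjoint[OF U]]]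
      density_diag(2)[OF density_conj_by[OF \<sigma> unitary_adjoint[OF U]]]
    by (simp add: sum.distrib)
  finally show ?thesis by (simp add: trace_distance_def X trace_norm_spectral[OF U])
qed

text \<open>Since \<open>N\<close> is the complement of \<open>M\<close>, the success equals 1 +
  Tr((\<rho> - \<sigma>) M). In the eigenbasis of the difference the diagonal of \<open>M\<close>
  lies in [0, 1], so at best it selects the positive eigenvalues.\<close>

lemma helstrom_upper:
  assumes \<rho>: "density_matrix n \<rho>" and \<sigma>: "density_matrix n \<sigma>"
    and M: "psd n M" and N: "psd n N" and MN: "M + N = 1\<^sub>m n"
  shows "Re (mtrace (\<rho> * M)) + Re (mtrace (\<sigma> * N)) \<le> 1 + trace_distance \<rho> \<sigma>"
proof -
  note c = psd_carrier[OF density_psd[OF \<rho>]] psd_carrier[OF density_psd[OF \<sigma>]] psd_carrier[OF M] psd_carrier[OF N]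
  have tr: "mtrace \<rho> = 1" "mtrace \<sigma> = 1" using \<rho> \<sigma> by (auto simp: density_matrix_def)
  obtain U l where U: "unitary n U" and X: "\<rho> - \<sigma> = conj_by U (diag_of n (\<lambda>i. complex_of_real (l i)))"
    using hermitian_spectral[OF hermitian_diff[OF density_psd[OF \<rho>] density_psd[OF \<sigma>]]] by blast
  note Uc = unitaryD[OF U]
  let ?M = "conj_by (mat_adjoint U) M" and ?N = "conj_by (mat_adjoint U) N"
  have Mc: "?M \<in> carrier_mat n n" "?N \<in> carrier_mat n n" using c Uc by auto
  have "?M + ?N = 1\<^sub>m n"
    using conj_by_add[OF Uc(2) c(3,4)] conj_by_one[OF unitary_adjoint[OF U]] MN by simp
  then have "?M $$ (k, k) + ?N $$ (k, k) = 1" if "k < n" for k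
    using that Mc by (metis carrier_matD index_add_mat(1) index_one_mat(1))
  then have "Re (?M $$ (k, k)) + Re (?N $$ (k, k)) = 1" if "k < n" for k
    using that by (metis one_complex.sel(1) plus_complex.sel(1))
  moreover have "0 \<le> Re (?M $$ (k, k))" "0 \<le> Re (?N $$ (k, k))" if "k < n" for k
    using psd_diag_nonneg[OF psd_conj_by[OF M Uc(2)] that]
      psd_diag_nonneg[OF psd_conj_by[OF N Uc(2)] that] by (simp_all add: less_eq_complex_def)
  ultimately have m: "0 \<le> Re (?M $$ (k, k))" "Re (?M $$ (k, k)) \<le> 1" if "k < n" for k
    using that by (force, force)
  have "mtrace (\<rho> - \<sigma>) = (\<Sum>k<n. complex_of_real (l k))"
    unfolding X mtrace_conj_by[OF U diag_of_carrier] by (simp add: mtrace_def)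
  then have "(\<Sum>k<n. complex_of_real (l k)) = 0" using mtrace_minus[OF c(1,2)] tr by simp
  then have l0: "(\<Sum>k<n. l k) = 0" by (metis of_real_eq_0_iff of_real_sum)
  have "\<sigma> * M + \<sigma> * N = \<sigma>"
    using c MN mult_add_distrib_mat[OF c(2,3,4)] by simp
  then have h1: "mtrace (\<sigma> * M) + mtrace (\<sigma> * N) = 1"
    using mtrace_add[of "\<sigma> * M" n "\<sigma> * N"] c tr by simp
  have h2: "mtrace ((\<rho> - \<sigma>) * M) = mtrace (\<rho> * M) - mtrace (\<sigma> * M)"
    using c by (simp add: minus_mult_distrib_mat[of _ n n _ _ n] mtrace_minus[of _ n])
  have "mtrace (\<rho> * M) + mtrace (\<sigma> * N) = 1 + mtrace ((\<rho> - \<sigma>) * M)"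
    unfolding h2 h1[symmetric] by simp
  then have "Re (mtrace (\<rho> * M)) + Re (mtrace (\<sigma> * N)) = 1 + Re (mtrace ((\<rho> - \<sigma>) * M))"
    by (metis one_complex.sel(1) plus_complex.sel(1))
  also have "Re (mtrace ((\<rho> - \<sigma>) * M)) = (\<Sum>k<n. l k * Re (?M $$ (k, k)))"
    unfolding X mtrace_spectral_mult[OF U c(3)] by simp
  \<comment> \<open>The right-hand summand is the positive part of \<open>l k\<close>. Its linear
    half sums to 0 by \<open>l0\<close>, because both states have trace 1.\<close>
  also have "\<dots> \<le> (\<Sum>k<n. l k / 2 + \<bar>l k\<bar> / 2)"
  proof (rule sum_mono)
    fix k assume "k \<in> {..<n}"
    then have m: "0 \<le> Re (?M $$ (k, k))" "Re (?M $$ (k, k)) \<le> 1" using m by auto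
    show "l k * Re (?M $$ (k, k)) \<le> l k / 2 + \<bar>l k\<bar> / 2"
    proof (cases "l k \<ge> 0")
      case True
      then show ?thesis using m mult_left_le[of "Re (?M $$ (k, k))" "l k"] by simp
    next
      case False
      then show ?thesis using m mult_nonpos_nonneg[of "l k" "Re (?M $$ (k, k))"] by simp
    qed
  qed
  also have "\<dots> = trace_distance \<rho> \<sigma>"
    by (simp add: trace_distance_def X trace_norm_spectral[OF U] sum.distrib l0 flip: sum_divide_distrib)
  finally show ?thesis by simp
qed

section \<open>Bounds on the supremum over POVMs\<close>

lemma povm_pair_sum:
  assumes "povm n {i, j} M" "i \<noteq> j"
  shows "M i + M j = 1\<^sub>m n"
proof -
  have "M i \<in> carrier_mat n n" "M j \<in> carrier_mat n n"
    using assms psd_carrier by (auto simp: povm_def)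
  then have "M i + M j = mat n n (\<lambda>rc. \<Sum>k\<in>{i, j}. M k $$ rc)"
    using assms(2) by (intro eq_matI) auto
  then show ?thesis using assms(1) by (simp add: povm_def)
qed

lemma max_success_pair_le:
  assumes "density_matrix n (\<rho> i)" "density_matrix n (\<rho> j)" "i \<noteq> j"
  shows "max_success n \<rho> {i, j} \<le> 1 + trace_distance (\<rho> i) (\<rho> j)"
  unfolding max_success_def
proof (rule cSup_least)
  \<comment> \<open>Bounding a supremum from above requires a nonempty set; always guessing
    \<open>i\<close> is a valid measurement.\<close>
  have "povm n {i, j} (\<lambda>k. if k = i then 1\<^sub>m n else 0\<^sub>m n n)"
    using assms(3) psd_one psd_zero by (auto simp: povm_def intro!: eq_matI)
  then show "{\<Sum>k\<in>{i, j}. Re (mtrace (\<rho> k * M k)) |M. povm n {i, j} M} \<noteq> {}" by blast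
  fix x assume "x \<in> {\<Sum>k\<in>{i, j}. Re (mtrace (\<rho> k * M k)) |M. povm n {i, j} M}"
  then obtain M where M: "povm n {i, j} M" and x: "x = (\<Sum>k\<in>{i, j}. Re (mtrace (\<rho> k * M k)))"
    by blast
  show "x \<le> 1 + trace_distance (\<rho> i) (\<rho> j)"
    using helstrom_upper[OF assms(1,2) _ _ povm_pair_sum[OF M assms(3)]] M assms(3)
    by (simp add: x povm_def)
qed

text \<open>A member lies below the supremum only if the set is bounded above. The crude bound is
  the trace of the identity, \<open>n\<close>, because each state contributes at most
  Tr(M_i).\<close>

lemma success_le_max_success:
  assumes \<rho>: "\<And>i. i \<in> H \<Longrightarrow> density_matrix n (\<rho> i)" and M: "povm n H M"
  shows "(\<Sum>i\<in>H. Re (mtrace (\<rho> i * M i))) \<le> max_success n \<rho> H"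
  unfolding max_success_def
proof (rule cSup_upper)
  show "bdd_above {\<Sum>i\<in>H. Re (mtrace (\<rho> i * M i)) |M. povm n H M}"
  proof (rule bdd_aboveI)
    fix x assume "x \<in> {\<Sum>i\<in>H. Re (mtrace (\<rho> i * M i)) |M. povm n H M}"
    then obtain M where M: "povm n H M" and x: "x = (\<Sum>i\<in>H. Re (mtrace (\<rho> i * M i)))" by blast
    have c: "M i \<in> carrier_mat n n" if "i \<in> H" for i
      using M that psd_carrier by (auto simp: povm_def)
    have "x \<le> (\<Sum>i\<in>H. Re (mtrace (M i)))"
      unfolding x using M by (intro sum_mono density_success_le[OF \<rho>]) (auto simp: povm_def)
    also have "\<dots> = (\<Sum>i\<in>H. \<Sum>k<n. Re (M i $$ (k, k)))"
      using c by (intro sum.cong refl) (simp add: mtrace_def carrier_matD(1)[OF c])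
    also have "\<dots> = Re (\<Sum>k<n. \<Sum>i\<in>H. M i $$ (k, k))"
      by (subst sum.swap) simp
    also have "(\<Sum>k<n. \<Sum>i\<in>H. M i $$ (k, k)) = mtrace (mat n n (\<lambda>rc. \<Sum>i\<in>H. M i $$ rc))"
      by (simp add: mtrace_def)
    also have "Re \<dots> = n" using M by (simp add: povm_def mtrace_def)
    finally show "x \<le> n" .
  qed
qed (use M in blast)

subsection \<open>The pretty good measurement\<close>

text \<open>For \<open>G = diag_of n g\<close> this is the squared Hilbert--Schmidt norm of
  \<open>G\<^bsup>-1/4\<^esup> X G\<^bsup>-1/4\<^esup>\<close>; entries with \<open>g a * g b = 0\<close> contribute \<open>0\<close>.\<close>

definition weighted_hs :: "nat \<Rightarrow> (nat \<Rightarrow> real) \<Rightarrow> complex mat \<Rightarrow> real" where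
  "weighted_hs n g X = (\<Sum>a<n. \<Sum>b<n. (cmod (X $$ (a, b)))\<^sup>2 / sqrt (g a * g b))"

text \<open>Cauchy-Schwarz for Tr(X W) with \<open>W\<close> the sign of \<open>X\<close>, after
  moving the fourth roots of \<open>g a * g b\<close> from one factor to the other. The factor with
  \<open>X\<close> becomes \<open>weighted_hs\<close>, the factor with \<open>W\<close> is at most
  Tr G.\<close>

lemma trace_norm_le_weighted_hs:
  assumes X: "X \<in> carrier_mat n n" "mat_adjoint X = X"
    and g: "\<And>a. a < n \<Longrightarrow> 0 \<le> g a"
    and X0: "\<And>a b. a < n \<Longrightarrow> b < n \<Longrightarrow> g a * g b = 0 \<Longrightarrow> X $$ (a, b) = 0"
  shows "(trace_norm X)\<^sup>2 \<le> (\<Sum>a<n. g a) * weighted_hs n g X"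
proof -
  obtain W where W: "unitary n W" and tn: "trace_norm X = Re (mtrace (X * W))"
    using trace_norm_attained[OF X] .
  let ?P = "{..<n} \<times> {..<n}"
  define r where "r = (\<lambda>(a, b). sqrt (sqrt (g a * g b)))"
  define w where "w = (\<lambda>(a, b). cmod (W $$ (b, a)))"
  define x where "x = (\<lambda>(a, b). cmod (X $$ (a, b)))"
  have r2: "(r (a, b))\<^sup>2 = sqrt (g a * g b)" if "a < n" "b < n" for a b
    using g that by (simp add: r_def)
  have "\<bar>trace_norm X\<bar> \<le> (\<Sum>p\<in>?P. (w p * r p) * (x p / r p))"
  proof -
    have "\<bar>trace_norm X\<bar> \<le> cmod (\<Sum>(a, b)\<in>?P. X $$ (a, b) * W $$ (b, a))"
      unfolding tn using X W abs_Re_le_cmod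
      by (simp add: mtrace_mult[of _ n n] unitaryD sum.cartesian_product del: Re_sum)
    also have "\<dots> \<le> (\<Sum>p\<in>?P. w p * x p)"
      by (rule sum_norm_le) (auto simp: w_def x_def norm_mult)
    \<comment> \<open>Where \<open>r p\<close> is 0 the cancellation fails, but there
      \<open>X0\<close> makes \<open>x p\<close> vanish too.\<close>
    also have "\<dots> = (\<Sum>p\<in>?P. (w p * r p) * (x p / r p))"
      using X0 by (intro sum.cong) (auto simp: x_def r_def)
    finally show ?thesis .
  qed
  also have "\<dots> = (\<Sum>p\<in>?P. \<bar>w p * r p\<bar> * \<bar>x p / r p\<bar>)"
    using g by (intro sum.cong) (auto simp: w_def r_def x_def)
  also have "\<dots> \<le> L2_set (\<lambda>p. w p * r p) ?P * L2_set (\<lambda>p. x p / r p) ?P"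
    by (rule L2_set_mult_ineq)
  finally have "(trace_norm X)\<^sup>2 \<le> (L2_set (\<lambda>p. w p * r p) ?P * L2_set (\<lambda>p. x p / r p) ?P)\<^sup>2"
    by (metis abs_ge_zero power2_abs power_mono)
  also have "\<dots> = (\<Sum>p\<in>?P. (w p * r p)\<^sup>2) * (\<Sum>p\<in>?P. (x p / r p)\<^sup>2)"
    by (simp add: L2_set_def power_mult_distrib sum_nonneg)
  also have "(\<Sum>p\<in>?P. (x p / r p)\<^sup>2) = weighted_hs n g X"
    unfolding weighted_hs_def sum.cartesian_product
    by (intro sum.cong) (auto simp: power_divide r2 x_def)
  also have "(\<Sum>p\<in>?P. (w p * r p)\<^sup>2) \<le> (\<Sum>a<n. g a)"
  proof -
    have "(\<Sum>p\<in>?P. (w p * r p)\<^sup>2) = (\<Sum>a<n. \<Sum>b<n. (cmod (W $$ (b, a)))\<^sup>2 * sqrt (g a * g b))"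
      unfolding sum.cartesian_product by (intro sum.cong) (auto simp: power_mult_distrib r2 w_def)
    \<comment> \<open>The arithmetic-geometric mean inequality separates \<open>a\<close> from
      \<open>b\<close>; then the unit rows and columns of \<open>W\<close> sum out the other
      index.\<close>
    also have "\<dots> \<le> (\<Sum>a<n. \<Sum>b<n. (cmod (W $$ (b, a)))\<^sup>2 * ((g a + g b) / 2))"
      using g by (intro sum_mono mult_left_mono arith_geo_mean_sqrt) auto
    also have "\<dots> = (\<Sum>a<n. \<Sum>b<n. (cmod (W $$ (b, a)))\<^sup>2 * g a) / 2
        + (\<Sum>a<n. \<Sum>b<n. (cmod (W $$ (b, a)))\<^sup>2 * g b) / 2"
      by (simp add: sum.distrib add_divide_distrib distrib_left sum_divide_distrib)
    also have "(\<Sum>a<n. \<Sum>b<n. (cmod (W $$ (b, a)))\<^sup>2 * g b) = (\<Sum>b<n. \<Sum>a<n. (cmod (W $$ (b, a)))\<^sup>2 * g b)"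
      by (rule sum.swap)
    also have "\<dots> = (\<Sum>b<n. g b)"
      by (intro sum.cong) (simp_all add: unitary_row_col_norm[OF W] flip: sum_distrib_right)
    also have "(\<Sum>a<n. \<Sum>b<n. (cmod (W $$ (b, a)))\<^sup>2 * g a) = (\<Sum>a<n. g a)"
      by (intro sum.cong) (simp_all add: unitary_row_col_norm[OF W] flip: sum_distrib_right)
    finally show ?thesis by simp
  qed
  \<comment> \<open>Bounding the first factor of the product is monotone only if the second is
    nonnegative, which is supplied next.\<close>
  finally have "(0 \<le> weighted_hs n g X \<Longrightarrow> (trace_norm X)\<^sup>2 \<le> (\<Sum>a<n. g a) * weighted_hs n g X)"
    by (simp add: mult_right_mono)
  moreover have "0 \<le> weighted_hs n g X"
    unfolding weighted_hs_def using g by (intro sum_nonneg) auto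
  ultimately show ?thesis by simp
qed

lemma weighted_hs_diag:
  assumes "\<And>a. a < n \<Longrightarrow> 0 \<le> g a"
  shows "weighted_hs n g (diag_of n (\<lambda>a. of_real (g a))) = (\<Sum>a<n. g a)"
  unfolding weighted_hs_def
proof (rule sum.cong)
  fix a assume "a \<in> {..<n}"
  then have a: "a < n" by simp
  have "(\<Sum>b<n. (cmod (diag_of n (\<lambda>a. of_real (g a)) $$ (a, b)))\<^sup>2 / sqrt (g a * g b))
      = (\<Sum>b<n. if b = a then (g a)\<^sup>2 / sqrt (g a * g a) else 0)"
    using a by (intro sum.cong) auto
  also have "\<dots> = g a" using a assms[OF a] by (simp add: power2_eq_square)
  finally show "(\<Sum>b<n. (cmod (diag_of n (\<lambda>a. of_real (g a)) $$ (a, b)))\<^sup>2 / sqrt (g a * g b)) = g a" .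
qed simp

text \<open>The three-vector form of the parallelogram law, applied to each entry with its own
  weight.\<close>

lemma weighted_hs_pairwise:
  assumes "A \<in> carrier_mat n n" "B \<in> carrier_mat n n" "C \<in> carrier_mat n n"
  shows "weighted_hs n g (A - B) + weighted_hs n g (A - C) + weighted_hs n g (B - C)
    = 3 * (weighted_hs n g A + weighted_hs n g B + weighted_hs n g C) - weighted_hs n g (A + B + C)"
proof -
  have *: "(cmod (x - y))\<^sup>2 / s + (cmod (x - z))\<^sup>2 / s + (cmod (y - z))\<^sup>2 / s
     = 3 * ((cmod x)\<^sup>2 / s + (cmod y)\<^sup>2 / s + (cmod z)\<^sup>2 / s) - (cmod (x + y + z))\<^sup>2 / s"
    for x y z :: complex and s :: real
  proof -
    have "(cmod (x - y))\<^sup>2 + (cmod (x - z))\<^sup>2 + (cmod (y - z))\<^sup>2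
        = 3 * ((cmod x)\<^sup>2 + (cmod y)\<^sup>2 + (cmod z)\<^sup>2) - (cmod (x + y + z))\<^sup>2"
      unfolding cmod_power2 by (simp add: power2_eq_square algebra_simps)
    then show ?thesis by (metis add_divide_distrib diff_divide_distrib times_divide_eq_right)
  qed
  show ?thesis
    unfolding weighted_hs_def sum_distrib_left sum.distrib[symmetric] sum_subtractf[symmetric]
  proof (intro sum.cong refl)
    fix a b assume "a \<in> {..<n}" "b \<in> {..<n}"
    then have "(A - B) $$ (a, b) = A $$ (a, b) - B $$ (a, b)" "(A - C) $$ (a, b) = A $$ (a, b) - C $$ (a, b)"
      "(B - C) $$ (a, b) = B $$ (a, b) - C $$ (a, b)"
      "(A + B + C) $$ (a, b) = A $$ (a, b) + B $$ (a, b) + C $$ (a, b)"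
      using assms by (simp_all add: add.assoc)
    then show "(cmod ((A - B) $$ (a, b)))\<^sup>2 / sqrt (g a * g b) + (cmod ((A - C) $$ (a, b)))\<^sup>2 / sqrt (g a * g b)
        + (cmod ((B - C) $$ (a, b)))\<^sup>2 / sqrt (g a * g b)
      = 3 * ((cmod (A $$ (a, b)))\<^sup>2 / sqrt (g a * g b) + (cmod (B $$ (a, b)))\<^sup>2 / sqrt (g a * g b)
        + (cmod (C $$ (a, b)))\<^sup>2 / sqrt (g a * g b)) - (cmod ((A + B + C) $$ (a, b)))\<^sup>2 / sqrt (g a * g b)"
      by (simp only: *)
  qed
qed

lemma conj_by_diag_of_index:
  assumes "A \<in> carrier_mat n n" "a < n" "b < n"
  shows "conj_by (diag_of n d) A $$ (a, b) = d a * A $$ (a, b) * cnj (d b)"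
  unfolding conj_by_def mat_adjoint_diag_of
  using assms by (subst diag_of_mult_index(2)) (auto simp: diag_of_mult_index(1) simp del: index_mult_mat(1))

text \<open>The conjugated part contributes exactly the weighted norm, as |A_ab|^2 picks up the
  weights of both indices. The diagonal part with \<open>e\<close> can only add to the
  success.\<close>

lemma pretty_good_term:
  fixes g e :: "nat \<Rightarrow> real"
  assumes A: "psd n A" and g: "\<And>a. a < n \<Longrightarrow> 0 \<le> g a" and e: "\<And>a. a < n \<Longrightarrow> 0 \<le> e a"
  shows "weighted_hs n g A
    \<le> Re (mtrace (A * (conj_by (diag_of n (\<lambda>a. of_real (1 / sqrt (g a)))) A + diag_of n (\<lambda>a. of_real (e a)))))"
proof -
  note c = psd_carrier[OF A]
  let ?D = "diag_of n (\<lambda>a. complex_of_real (1 / sqrt (g a)))" and ?E = "diag_of n (\<lambda>a. complex_of_real (e a))"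
  have "mtrace (A * (conj_by ?D A + ?E)) = mtrace (A * conj_by ?D A) + mtrace (A * ?E)"
    using c by (simp add: mult_add_distrib_mat[of _ n n _ n] mtrace_add[of _ n])
  moreover have "mtrace (A * ?E) = (\<Sum>a<n. of_real (e a) * A $$ (a, a))"
    using c mtrace_mult_comm[of A n n ?E] by (simp add: mtrace_diag_mult)
  moreover have "0 \<le> Re (\<Sum>a<n. of_real (e a) * A $$ (a, a))"
    using e psd_diag_nonneg[OF A] by (auto simp: less_eq_complex_def intro!: sum_nonneg)
  moreover have "mtrace (A * conj_by ?D A) = of_real (weighted_hs n g A)"
  proof -
    have "A $$ (a, b) * (conj_by ?D A) $$ (b, a) = of_real ((cmod (A $$ (a, b)))\<^sup>2 / sqrt (g a * g b))"
      if ab: "a < n" "b < n" for a b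
    proof -
      have "A $$ (a, b) * (conj_by ?D A) $$ (b, a)
          = (A $$ (a, b) * cnj (A $$ (a, b))) * of_real (1 / sqrt (g a) * (1 / sqrt (g b)))"
        using c ab by (simp add: conj_by_diag_of_index psd_symmetric_entry[OF A ab])
      also have "\<dots> = of_real ((cmod (A $$ (a, b)))\<^sup>2 / sqrt (g a * g b))"
        unfolding complex_norm_square[symmetric] by (simp add: real_sqrt_mult)
      finally show ?thesis .
    qed
    then show ?thesis using c by (simp add: mtrace_mult[of _ n n] weighted_hs_def)
  qed
  ultimately show ?thesis by simp
qed

text \<open>All computations take place in the eigenbasis of G, where G^(-1/2) is diagonal; the
  states \<open>\<sigma> i\<close> live there, and the measurement \<open>N\<close> is rotated back
  to \<open>M\<close> at the end.\<close>

lemma pretty_good_measurement: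
  assumes \<rho>: "\<And>i. i \<in> {1, 2, 3} \<Longrightarrow> density_matrix n (\<rho> i)"
  defines "T \<equiv> trace_distance (\<rho> 1) (\<rho> 2) + trace_distance (\<rho> 1) (\<rho> 3) + trace_distance (\<rho> 2) (\<rho> 3)"
  obtains M where "povm n {1, 2, 3::nat} M"
    "1 + 4 * T\<^sup>2 / 27 \<le> (\<Sum>i\<in>{1, 2, 3}. Re (mtrace (\<rho> i * M i)))"
proof -
  have \<rho>p: "psd n (\<rho> i)" and \<rho>c: "\<rho> i \<in> carrier_mat n n" if "i \<in> {1, 2, 3}" for i
    using \<rho>[OF that] density_psd psd_carrier by auto
  let ?G = "\<rho> 1 + \<rho> 2 + \<rho> 3"
  have G: "psd n ?G" using \<rho>p by (intro psd_add) auto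
  obtain U g where U: "unitary n U" and GU: "?G = conj_by U (diag_of n (\<lambda>a. complex_of_real (g a)))"
    using hermitian_spectral[OF psd_carrier[OF G] psd_hermitian[OF G]] by blast
  note Uc = unitaryD[OF U]
  define \<sigma> where "\<sigma> i = conj_by (mat_adjoint U) (\<rho> i)" for i
  have \<sigma>d: "density_matrix n (\<sigma> i)" if "i \<in> {1, 2, 3}" for i
    unfolding \<sigma>_def by (rule density_conj_by[OF \<rho>[OF that] unitary_adjoint[OF U]])
  have \<sigma>p: "psd n (\<sigma> i)" and \<sigma>c: "\<sigma> i \<in> carrier_mat n n" if "i \<in> {1, 2, 3}" for i
    using \<sigma>d[OF that] density_psd psd_carrier by auto
  have \<rho>\<sigma>: "\<rho> i = conj_by U (\<sigma> i)" if "i \<in> {1, 2, 3}" for i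
    unfolding \<sigma>_def using conj_by_adjoint_cancel(2)[OF U \<rho>c[OF that]] by simp
  have \<sigma>sum: "\<sigma> 1 + \<sigma> 2 + \<sigma> 3 = diag_of n (\<lambda>a. complex_of_real (g a))"
    unfolding \<sigma>_def using \<rho>c Uc GU conj_by_adjoint_cancel(1)[OF U, of "diag_of n (\<lambda>a. complex_of_real (g a))"]
    by (simp flip: conj_by_add[of _ n])
  have entry: "\<sigma> 1 $$ (a, b) + \<sigma> 2 $$ (a, b) + \<sigma> 3 $$ (a, b) = (if a = b then of_real (g a) else 0)"
    if "a < n" "b < n" for a b
    using arg_cong[OF \<sigma>sum, of "\<lambda>X. X $$ (a, b)"] \<sigma>c[of 1] \<sigma>c[of 2] \<sigma>c[of 3] that
    by (auto simp: add.assoc)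
  have gsum: "g a = Re (\<sigma> 1 $$ (a, a)) + Re (\<sigma> 2 $$ (a, a)) + Re (\<sigma> 3 $$ (a, a))" if "a < n" for a
    using arg_cong[OF entry[OF that that], of Re] by simp
  have \<sigma>n: "0 \<le> Re (\<sigma> i $$ (a, a))" if "a < n" "i \<in> {1, 2, 3}" for a i
    using density_diag(1)[OF \<sigma>d[OF that(2)] that(1)] .
  have g: "0 \<le> g a" if "a < n" for a
    using gsum[OF that] \<sigma>n[OF that, of 1] \<sigma>n[OF that, of 2] \<sigma>n[OF that, of 3] by simp
  have g3: "(\<Sum>a<n. g a) = 3"
    using density_diag(2)[OF \<sigma>d[of 1]] density_diag(2)[OF \<sigma>d[of 2]] density_diag(2)[OF \<sigma>d[of 3]]
    by (simp add: gsum sum.distrib)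
  \<comment> \<open>If \<open>g c\<close> is 0, the three nonnegative diagonal entries that sum to
    it vanish, and with them the whole row and column of each state. Division by 0 is thus
    harmless.\<close>
  have \<sigma>0: "\<sigma> i $$ (a, b) = 0" if ab: "a < n" "b < n" "g a * g b = 0" and i: "i \<in> {1, 2, 3}" for i a b
  proof -
    have z: "\<sigma> i $$ (c, c) = 0" if c: "c < n" "g c = 0" for c
      using gsum[OF c(1)] c(2) \<sigma>n[OF c(1), of 1] \<sigma>n[OF c(1), of 2] \<sigma>n[OF c(1), of 3] i
        psd_diag_nonneg[OF \<sigma>p[OF i] c(1)]
      by (auto simp: less_eq_complex_def complex_eq_iff)
    consider "g a = 0" | "g b = 0" using ab by auto
    then show ?thesis
    proof cases
      case 1
      then show ?thesis using psd_zero_diag[OF \<sigma>p[OF i] ab(1,2)] z ab by simp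
    next
      case 2
      then show ?thesis using psd_zero_diag[OF \<sigma>p[OF i] ab(2,1)] z ab
          psd_symmetric_entry[OF \<sigma>p[OF i] ab(2,1)] by simp
    qed
  qed
  define Q where "Q = weighted_hs n g"
  \<comment> \<open>The factor 3 is Tr G, the sum of three unit traces.\<close>
  have tn: "(trace_norm (\<rho> i - \<rho> j))\<^sup>2 \<le> 3 * Q (\<sigma> i - \<sigma> j)"
    if ij: "i \<in> {1, 2, 3}" "j \<in> {1, 2, 3}" for i j
  proof -
    have "trace_norm (\<rho> i - \<rho> j) = trace_norm (\<sigma> i - \<sigma> j)"
      unfolding \<rho>\<sigma>[OF ij(1)] \<rho>\<sigma>[OF ij(2)]
      using \<sigma>c[OF ij(1)] \<sigma>c[OF ij(2)] Uc hermitian_diff(1)[OF \<sigma>p[OF ij(1)] \<sigma>p[OF ij(2)]] trace_norm_conj_by[OF U, of "\<sigma> i - \<sigma> j"]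
      by (simp add: conj_by_minus[of _ n])
    moreover have "(trace_norm (\<sigma> i - \<sigma> j))\<^sup>2 \<le> (\<Sum>a<n. g a) * weighted_hs n g (\<sigma> i - \<sigma> j)"
    proof (rule trace_norm_le_weighted_hs[OF hermitian_diff[OF \<sigma>p[OF ij(1)] \<sigma>p[OF ij(2)]] g])
      show "(\<sigma> i - \<sigma> j) $$ (a, b) = 0" if "a < n" "b < n" "g a * g b = 0" for a b
        using \<sigma>0[OF that ij(1)] \<sigma>0[OF that ij(2)] \<sigma>c[OF ij(1)] \<sigma>c[OF ij(2)] that by simp
    qed
    ultimately show ?thesis by (simp add: Q_def g3)
  qed
  have "weighted_hs n g (\<sigma> 1 + \<sigma> 2 + \<sigma> 3) = 3"
    unfolding \<sigma>sum by (subst weighted_hs_diag) (simp_all add: g g3)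
  then have Qsum: "Q (\<sigma> 1 - \<sigma> 2) + Q (\<sigma> 1 - \<sigma> 3) + Q (\<sigma> 2 - \<sigma> 3) = 3 * (Q (\<sigma> 1) + Q (\<sigma> 2) + Q (\<sigma> 3)) - 3"
    using weighted_hs_pairwise[of "\<sigma> 1" n "\<sigma> 2" "\<sigma> 3" g] \<sigma>c
    by (simp add: Q_def)
  have T: "1 + 4 * T\<^sup>2 / 27 \<le> Q (\<sigma> 1) + Q (\<sigma> 2) + Q (\<sigma> 3)"
  proof -
    let ?x = "trace_norm (\<rho> 1 - \<rho> 2)" and ?y = "trace_norm (\<rho> 1 - \<rho> 3)" and ?z = "trace_norm (\<rho> 2 - \<rho> 3)"
    \<comment> \<open>Expanding these squares gives (x + y + z)^2 <= 3(x^2 + y^2 + z^2). With x + y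
      + z = 2T, \<open>tn\<close> and \<open>Qsum\<close>, this yields 4T^2 <= 9(3P - 3), where P is
      the sum of the three \<open>Q (\<sigma> i)\<close>.\<close>
    have "0 \<le> (?x - ?y)\<^sup>2 + (?x - ?z)\<^sup>2 + (?y - ?z)\<^sup>2" by simp
    then have "(?x + ?y + ?z)\<^sup>2 \<le> 3 * (?x\<^sup>2 + ?y\<^sup>2 + ?z\<^sup>2)"
      by (simp add: power2_eq_square algebra_simps)
    also have "\<dots> \<le> 27 * (Q (\<sigma> 1) + Q (\<sigma> 2) + Q (\<sigma> 3)) - 27"
      using tn[of 1 2] tn[of 1 3] tn[of 2 3] Qsum by simp
    also have "?x + ?y + ?z = 2 * T" by (simp add: T_def trace_distance_def)
    finally show ?thesis by (simp add: power_mult_distrib)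
  qed
  let ?D = "diag_of n (\<lambda>a. complex_of_real (1 / sqrt (g a)))"
  \<comment> \<open>Since \<open>1 / sqrt 0 = 0\<close>, the outcome operators alone would only sum to the projection onto the range of
    \<open>G\<close>; the term \<open>e\<close> assigns the kernel of \<open>G\<close> to the first outcome.\<close>
  define e :: "nat \<Rightarrow> nat \<Rightarrow> real" where "e i a = (if i = 1 \<and> g a = 0 then 1 else 0)" for i a
  define N where "N i = conj_by ?D (\<sigma> i) + diag_of n (\<lambda>a. complex_of_real (e i a))" for i
  define M where "M i = conj_by U (N i)" for i
  have Np: "psd n (N i)" and Nc: "N i \<in> carrier_mat n n" if "i \<in> {1, 2, 3}" for i
  proof -
    show "psd n (N i)"
      unfolding N_def by (intro psd_add psd_conj_by[OF \<sigma>p[OF that]] psd_diag_of)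
      (auto simp: e_def less_eq_complex_def)
    then show "N i \<in> carrier_mat n n" by (rule psd_carrier)
  qed
  have Nsum: "N 1 + N 2 + N 3 = 1\<^sub>m n"
  proof (rule eq_matI)
    fix a b assume "a < dim_row (1\<^sub>m n)" "b < dim_col (1\<^sub>m n)"
    then have ab: "a < n" "b < n" by auto
    let ?d = "\<lambda>a. complex_of_real (1 / sqrt (g a))"
    have "(N 1 + N 2 + N 3) $$ (a, b) = N 1 $$ (a, b) + N 2 $$ (a, b) + N 3 $$ (a, b)"
      using Nc[of 1] Nc[of 2] Nc[of 3] ab by simp
    also have "\<dots> = ?d a * ?d b * (\<sigma> 1 $$ (a, b) + \<sigma> 2 $$ (a, b) + \<sigma> 3 $$ (a, b))
        + (if a = b then of_real (e 1 a + e 2 a + e 3 a) else 0)"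
      using ab \<sigma>c conj_by_carrier[OF diag_of_carrier \<sigma>c]
      by (simp add: N_def conj_by_diag_of_index carrier_matD[of _ n n] algebra_simps)
    also have "\<dots> = 1\<^sub>m n $$ (a, b)"
    proof (cases "a = b")
      case True
      \<comment> \<open>For positive \<open>g a\<close> the product is 1 and \<open>e\<close>
        vanishes; for \<open>g a = 0\<close> the product is 0 and \<open>e 1 a\<close> supplies the
        1.\<close>
      have "1 / sqrt (g a) * (1 / sqrt (g a)) * g a + (e 1 a + e 2 a + e 3 a) = 1"
        using g[OF ab(1)] by (simp add: e_def)
      then have "?d a * ?d a * of_real (g a) + of_real (e 1 a + e 2 a + e 3 a) = 1"
        by (metis of_real_1 of_real_add of_real_mult)
      then show ?thesis unfolding entry[OF ab] using True ab
        by (simp only: if_True index_one_mat simp_thms)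
    next
      case False
      then show ?thesis unfolding entry[OF ab] using ab by simp
    qed
    finally show "(N 1 + N 2 + N 3) $$ (a, b) = 1\<^sub>m n $$ (a, b)" .
  qed (use Nc[of 1] Nc[of 2] Nc[of 3] in auto)
  have Mc: "M i \<in> carrier_mat n n" if "i \<in> {1, 2, 3}" for i
    unfolding M_def using Nc[OF that] Uc by simp
  have "povm n {1, 2, 3} M"
    unfolding povm_def
  proof
    show "\<forall>i\<in>{1, 2, 3}. psd n (M i)"
      unfolding M_def using psd_conj_by[OF Np Uc(1)] by blast
    have "mat n n (\<lambda>rc. \<Sum>i\<in>{1, 2, 3}. M i $$ rc) = M 1 + M 2 + M 3"
      using Mc[of 1] Mc[of 2] Mc[of 3] by (intro eq_matI) auto
    also have "\<dots> = conj_by U (N 1 + N 2 + N 3)"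
      using Nc Uc by (simp add: M_def conj_by_add[of _ n])
    also have "\<dots> = 1\<^sub>m n" unfolding Nsum by (rule conj_by_one[OF U])
    finally show "mat n n (\<lambda>rc. \<Sum>i\<in>{1, 2, 3}. M i $$ rc) = 1\<^sub>m n" .
  qed
  moreover have "Q (\<sigma> i) \<le> Re (mtrace (\<rho> i * M i))" if i: "i \<in> {1, 2, 3}" for i
  proof -
    have "mtrace (\<rho> i * M i) = mtrace (\<sigma> i * N i)"
      unfolding \<rho>\<sigma>[OF i] M_def using \<sigma>c[OF i] Nc[OF i]
      by (simp add: conj_by_mult[OF U] mtrace_conj_by[OF U])
    moreover have "Q (\<sigma> i) \<le> Re (mtrace (\<sigma> i * N i))"
      unfolding N_def Q_def by (rule pretty_good_term[OF \<sigma>p[OF i] g]) (auto simp: e_def)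
    ultimately show ?thesis by simp
  qed
  then have "(\<Sum>i\<in>{1, 2, 3}. Q (\<sigma> i)) \<le> (\<Sum>i\<in>{1, 2, 3}. Re (mtrace (\<rho> i * M i)))"
    by (rule sum_mono)
  then have "1 + 4 * T\<^sup>2 / 27 \<le> (\<Sum>i\<in>{1, 2, 3}. Re (mtrace (\<rho> i * M i)))"
    using T by simp
  ultimately show ?thesis by (rule that)
qed

theorem theorem6p2:
  fixes n :: nat and \<rho> :: "nat \<Rightarrow> complex mat" and T \<beta> :: real
  assumes "\<forall>i\<in>{1, 2, 3}. density_matrix n (\<rho> i)"
    and "T = trace_distance (\<rho> 1) (\<rho> 2) + trace_distance (\<rho> 1) (\<rho> 3)
             + trace_distance (\<rho> 2) (\<rho> 3)"
    and "\<beta> = min_error n \<rho> {1, 2, 3} - min_error n \<rho> {1, 2} - min_error n \<rho> {1, 3}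
             - min_error n \<rho> {2, 3}"
  shows "\<beta> \<le> T - 1 - 4 * T^2 / 27 \<and> T - 1 - 4 * T^2 / 27 \<le> 2 / 3"
proof
  have d: "density_matrix n (\<rho> i)" if "i \<in> {1, 2, 3}" for i using assms(1) that by blast
  obtain M where M: "povm n {1, 2, 3} M"
      "1 + 4 * T\<^sup>2 / 27 \<le> (\<Sum>i\<in>{1, 2, 3}. Re (mtrace (\<rho> i * M i)))"
    using pretty_good_measurement[of n \<rho>] d assms(2) by blast
  then have "1 + 4 * T\<^sup>2 / 27 \<le> max_success n \<rho> {1, 2, 3}"
    using success_le_max_success[of "{1, 2, 3}" n \<rho> M] d by force
  moreover have "max_success n \<rho> {1, 2} \<le> 1 + trace_distance (\<rho> 1) (\<rho> 2)"
    "max_success n \<rho> {1, 3} \<le> 1 + trace_distance (\<rho> 1) (\<rho> 3)"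
    "max_success n \<rho> {2, 3} \<le> 1 + trace_distance (\<rho> 2) (\<rho> 3)"
    using d by (auto intro!: max_success_pair_le)
  \<comment> \<open>The cardinalities contribute 3 - 6 = -3, which cancels the three ones in the
    Helstrom bounds; the three-state success bound leaves the -1 and the quadratic term.\<close>
  ultimately show "\<beta> \<le> T - 1 - 4 * T^2 / 27"
    unfolding assms(2,3) min_error_def by simp
  have "trace_distance (\<rho> 1) (\<rho> 2) \<le> 1" "trace_distance (\<rho> 1) (\<rho> 3) \<le> 1"
    "trace_distance (\<rho> 2) (\<rho> 3) \<le> 1"
    using d by (auto intro!: trace_distance_le_1)
  then have "T \<le> 3" by (simp add: assms(2))
  \<comment> \<open>The product is 45 - 27T + 4T^2, that is 27 times the gap in the claim, which
    closes at T = 3.\<close>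
  then have "0 \<le> (15 - 4 * T) * (3 - T)" by (intro mult_nonneg_nonneg) auto
  then show "T - 1 - 4 * T^2 / 27 \<le> 2 / 3" by (simp add: algebra_simps power2_eq_square)
qed

end
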